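(* If $n\in N$ is a prime number and $n\mid xy$ for some $x,y\in\beta N$, then $n\mid x$ or $n\mid y$.
   Context: $N=\{1,2,3,\dots\}$ and $\beta N$ is the set of all ultrafilters on $N$; each $n\in N$ is identified with the principal ultrafilter $\{A\subseteq N:n\in A\}$. For $A\subseteq N$ and $n\in N$, $A/n=\{m\in N:mn\in A\}$. Multiplication on $\beta N$ (extending that of $N$) is defined by: $A\in p\cdot q$ if and only if $\{n\in N:A/n\in q\}\in p$. For $n\in N$ and $z\in\beta N$, $n\mid z$ means that there is $r\in\beta N$ such that $z=nr$ (equivalently $z=rn$, since elements of $N$ commute with all elements of $\beta N$). *)

theory Defs
  imports "HOL-Computational_Algebra.Primes"
begin

abbreviation pos_nats :: "nat set" where
  "pos_nats \<equiv> {1..}"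

definition ultrafilter_on :: "'a set \<Rightarrow> 'a set set \<Rightarrow> bool" where
  "ultrafilter_on X U \<longleftrightarrow>
     U \<subseteq> Pow X \<and> X \<in> U \<and> {} \<notin> U \<and>
     (\<forall>A\<in>U. \<forall>B\<in>U. A \<inter> B \<in> U) \<and>
     (\<forall>A\<in>U. \<forall>B. A \<subseteq> B \<and> B \<subseteq> X \<longrightarrow> B \<in> U) \<and>
     (\<forall>A. A \<subseteq> X \<longrightarrow> A \<in> U \<or> X - A \<in> U)"

definition betaN :: "nat set set set" where
  "betaN = {U. ultrafilter_on pos_nats U}"

definition principal_uf :: "nat \<Rightarrow> nat set set" where
  "principal_uf n = {A. A \<subseteq> pos_nats \<and> n \<in> A}"

definition set_quot :: "nat set \<Rightarrow> nat \<Rightarrow> nat set" where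
  "set_quot A n = {m \<in> pos_nats. m * n \<in> A}"

definition beta_mult :: "nat set set \<Rightarrow> nat set set \<Rightarrow> nat set set"
    (infixl \<open>\<odot>\<close> 70) where
  "p \<odot> q = {A. A \<subseteq> pos_nats \<and> {n \<in> pos_nats. set_quot A n \<in> q} \<in> p}"

text \<open>Divisibility of an ultrafilter by a positive natural number, the latter being
  identified with its principal ultrafilter.\<close>

definition beta_dvd :: "nat \<Rightarrow> nat set set \<Rightarrow> bool" where
  "beta_dvd n z \<longleftrightarrow> (\<exists>r\<in>betaN. z = principal_uf n \<odot> r)"

lemma principal_uf_in_betaN: "n \<in> pos_nats \<Longrightarrow> principal_uf n \<in> betaN"
  by (auto simp: betaN_def ultrafilter_on_def principal_uf_def)

lemma beta_mult_principal_uf: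
  assumes "m \<in> pos_nats" "n \<in> pos_nats"
  shows "principal_uf m \<odot> principal_uf n = principal_uf (m * n)"
  using assms by (auto simp: beta_mult_def principal_uf_def set_quot_def mult.commute)

lemma beta_mult_in_betaN:
  assumes p: "p \<in> betaN" and q: "q \<in> betaN"
  shows "p \<odot> q \<in> betaN"
proof -
  let ?N = pos_nats
  let ?E = "\<lambda>A. {n \<in> ?N. set_quot A n \<in> q}"
  have P: "p \<subseteq> Pow ?N" "?N \<in> p" "{} \<notin> p"
      "\<And>A B. A \<in> p \<Longrightarrow> B \<in> p \<Longrightarrow> A \<inter> B \<in> p"
      "\<And>A B. A \<in> p \<Longrightarrow> A \<subseteq> B \<Longrightarrow> B \<subseteq> ?N \<Longrightarrow> B \<in> p"
      "\<And>A. A \<subseteq> ?N \<Longrightarrow> A \<in> p \<or> ?N - A \<in> p"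
    using p by (simp_all add: betaN_def ultrafilter_on_def)
  have Q: "q \<subseteq> Pow ?N" "?N \<in> q" "{} \<notin> q"
      "\<And>A B. A \<in> q \<Longrightarrow> B \<in> q \<Longrightarrow> A \<inter> B \<in> q"
      "\<And>A B. A \<in> q \<Longrightarrow> A \<subseteq> B \<Longrightarrow> B \<subseteq> ?N \<Longrightarrow> B \<in> q"
      "\<And>A. A \<subseteq> ?N \<Longrightarrow> A \<in> q \<or> ?N - A \<in> q"
    using q by (simp_all add: betaN_def ultrafilter_on_def)
  have quot_sub: "set_quot A n \<subseteq> ?N" for A n by (auto simp: set_quot_def)
  have quot_N: "set_quot ?N n = ?N" if "n \<in> ?N" for n
    using that by (auto simp: set_quot_def)
  have quot_int: "set_quot (A \<inter> B) n = set_quot A n \<inter> set_quot B n" for A B n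
    by (auto simp: set_quot_def)
  have quot_mono: "set_quot A n \<subseteq> set_quot B n" if "A \<subseteq> B" for A B n
    using that by (auto simp: set_quot_def)
  have quot_compl: "set_quot (?N - A) n = ?N - set_quot A n" if "n \<in> ?N" for A n
    using that by (auto simp: set_quot_def)
  have E_N: "?E ?N = ?N" using quot_N Q(2) by auto
  have E_empty: "?E {} = {}" using Q(3) by (simp add: set_quot_def)
  have E_int: "?E A \<inter> ?E B \<subseteq> ?E (A \<inter> B)" for A B
    using Q(4) by (auto simp: quot_int)
  have E_mono: "?E A \<subseteq> ?E B" if "A \<subseteq> B" for A B
    using Q(5)[OF _ quot_mono[OF that] quot_sub] by auto
  have E_compl: "?N - ?E A \<subseteq> ?E (?N - A)" for A
  proof
    fix n assume "n \<in> ?N - ?E A"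
    then have n: "n \<in> ?N" "set_quot A n \<notin> q" by auto
    then have "?N - set_quot A n \<in> q" using Q(6)[OF quot_sub] by blast
    then show "n \<in> ?E (?N - A)" using n(1) quot_compl[OF n(1), of A] by simp
  qed
  have mem: "A \<in> p \<odot> q \<longleftrightarrow> A \<subseteq> ?N \<and> ?E A \<in> p" for A
    by (simp add: beta_mult_def)
  have E_sub: "?E A \<subseteq> ?N" for A by blast
  have up: "?E B \<in> p" if "C \<in> p" "C \<subseteq> ?E B" for B C
    by (rule P(5)[OF that E_sub])
  show ?thesis
    unfolding betaN_def mem_Collect_eq ultrafilter_on_def
  proof (intro conjI ballI allI impI)
    show "p \<odot> q \<subseteq> Pow ?N" by (auto simp: beta_mult_def)
    show "?N \<in> p \<odot> q" unfolding mem E_N using P(2) by simp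
    show "{} \<notin> p \<odot> q" unfolding mem E_empty using P(3) by simp
    fix A
    show "A \<inter> B \<in> p \<odot> q" if "A \<in> p \<odot> q" "B \<in> p \<odot> q" for B
    proof -
      have "?E A \<inter> ?E B \<in> p" using that by (intro P(4)) (simp_all add: mem)
      then have "?E (A \<inter> B) \<in> p" by (rule up[OF _ E_int])
      then show ?thesis using that(1) by (auto simp: mem)
    qed
    show "B \<in> p \<odot> q" if "A \<in> p \<odot> q" "A \<subseteq> B \<and> B \<subseteq> ?N" for B
    proof -
      have "?E A \<in> p" using that(1) by (simp add: mem)
      then have "?E B \<in> p" by (rule up[OF _ E_mono]) (use that(2) in simp)
      then show ?thesis using that(2) by (simp add: mem)
    qed
    assume A: "A \<subseteq> ?N"
    from P(6)[OF E_sub, of A] show "A \<in> p \<odot> q \<or> ?N - A \<in> p \<odot> q"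
    proof
      assume "?E A \<in> p"
      then show ?thesis using A by (simp add: mem)
    next
      assume "?N - ?E A \<in> p"
      then have "?E (?N - A) \<in> p" by (rule up[OF _ E_compl])
      then show ?thesis by (simp add: mem)
    qed
  qed
qed

end

theory Submission
  imports Defs
begin

text \<open>
  Divisibility of an ultrafilter \<open>z\<close> by a positive natural number \<open>n\<close> is decided by a single set:
  \<open>n\<close> divides \<open>z\<close> exactly when the set \<open>nN\<close> of multiples of \<open>n\<close> is a member of \<open>z\<close>, because
  multiplication by \<open>n\<close> is a bijection from \<open>N\<close> onto \<open>nN\<close>, along which an ultrafilter
  concentrated on \<open>nN\<close> can be pulled back (\<open>beta_dvd_iff_multiples_mem\<close>).

  For a prime \<open>n\<close>, Euclid's lemma says that the quotient \<open>(nN)/m\<close> takes only two values: all of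
  \<open>N\<close> if \<open>n\<close> divides \<open>m\<close>, and \<open>nN\<close> otherwise. So if \<open>nN\<close> is not in \<open>y\<close>, then the set of those \<open>m\<close>
  with \<open>(nN)/m \<in> y\<close> is \<open>nN\<close> itself, and \<open>nN \<in> x \<odot> y\<close> turns into \<open>nN \<in> x\<close>.
\<close>

definition multiples :: "nat \<Rightarrow> nat set" where
  "multiples n = {m \<in> pos_nats. n dvd m}"

lemma multiples_subset: "multiples n \<subseteq> pos_nats"
  by (auto simp: multiples_def)

lemma mem_principal_uf_mult:
  assumes "n \<in> pos_nats"
  shows "A \<in> principal_uf n \<odot> r \<longleftrightarrow> A \<subseteq> pos_nats \<and> set_quot A n \<in> r"
  using assms by (auto simp: beta_mult_def principal_uf_def)

lemma image_mult_pos_nats: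
  assumes "n \<in> pos_nats"
  shows "(*) n ` pos_nats = multiples n"
  using assms by (auto simp: multiples_def image_iff elim!: dvdE)

lemma image_mult_set_quot:
  assumes "n \<in> pos_nats" "A \<subseteq> pos_nats"
  shows "(*) n ` set_quot A n = A \<inter> multiples n"
proof
  show "(*) n ` set_quot A n \<subseteq> A \<inter> multiples n"
    using assms by (auto simp: set_quot_def multiples_def mult.commute)
  show "A \<inter> multiples n \<subseteq> (*) n ` set_quot A n"
  proof
    fix a assume a: "a \<in> A \<inter> multiples n"
    then obtain k where "a = n * k" "k \<in> pos_nats"
      using image_mult_pos_nats[OF assms(1)] by blast
    with a show "a \<in> (*) n ` set_quot A n"
      by (auto simp: set_quot_def mult.commute)
  qed
qed

text \<open>The pullback of an ultrafilter along multiplication by \<open>n\<close>. Since \<open>z\<close> is concentrated on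
  the range \<open>nN\<close> of this map, it contains \<open>nN\<close> and one of the two sets \<open>nB\<close> and \<open>n(N - B)\<close>;
  injectivity makes images commute with intersections and differences.\<close>

lemma pullback_mult_in_betaN:
  assumes n: "n \<in> pos_nats" and z: "z \<in> betaN" and conc: "multiples n \<in> z"
  shows "{B. B \<subseteq> pos_nats \<and> (*) n ` B \<in> z} \<in> betaN"
proof -
  let ?N = pos_nats
  have Z: "{} \<notin> z"
      "\<And>A B. A \<in> z \<Longrightarrow> B \<in> z \<Longrightarrow> A \<inter> B \<in> z"
      "\<And>A B. A \<in> z \<Longrightarrow> A \<subseteq> B \<Longrightarrow> B \<subseteq> ?N \<Longrightarrow> B \<in> z"
      "\<And>A. A \<subseteq> ?N \<Longrightarrow> A \<in> z \<or> ?N - A \<in> z"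
    using z by (simp_all add: betaN_def ultrafilter_on_def)
  have inj: "inj ((*) n)"
    using n by (auto intro: injI)
  have sub: "(*) n ` B \<subseteq> ?N" if "B \<subseteq> ?N" for B
    using image_mono[OF that, of "(*) n"] image_mult_pos_nats[OF n] multiples_subset[of n]
    by blast
  have compl: "(*) n ` (?N - B) \<in> z" if B: "B \<subseteq> ?N" and notin: "(*) n ` B \<notin> z" for B
  proof -
    have "?N - (*) n ` B \<in> z"
      using Z(4)[OF sub[OF B]] notin by blast
    then have "multiples n \<inter> (?N - (*) n ` B) \<in> z"
      by (rule Z(2)[OF conc])
    moreover have "multiples n \<inter> (?N - (*) n ` B) = (*) n ` (?N - B)"
      using multiples_subset[of n]
      unfolding image_set_diff[OF inj] image_mult_pos_nats[OF n] by blast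
    ultimately show ?thesis by simp
  qed
  show ?thesis
    unfolding betaN_def mem_Collect_eq ultrafilter_on_def
  proof (intro conjI ballI allI impI; (unfold mem_Collect_eq)?)
    show "{B. B \<subseteq> ?N \<and> (*) n ` B \<in> z} \<subseteq> Pow ?N" by blast
    show "?N \<subseteq> ?N" "(*) n ` ?N \<in> z"
      using conc image_mult_pos_nats[OF n] by simp_all
    show "\<not> ({} \<subseteq> ?N \<and> (*) n ` {} \<in> z)" using Z(1) by simp
  next
    fix A B
    assume "A \<subseteq> ?N \<and> (*) n ` A \<in> z" "B \<subseteq> ?N \<and> (*) n ` B \<in> z"
    then show "A \<inter> B \<subseteq> ?N" "(*) n ` (A \<inter> B) \<in> z"
      using Z(2) by (auto simp: image_Int[OF inj])
  next
    fix A B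
    assume "A \<subseteq> ?N \<and> (*) n ` A \<in> z" "A \<subseteq> B \<and> B \<subseteq> ?N"
    then show "B \<subseteq> ?N" "(*) n ` B \<in> z"
      using Z(3)[OF _ image_mono sub] by blast+
  next
    fix A assume "A \<subseteq> ?N"
    then show "A \<subseteq> ?N \<and> (*) n ` A \<in> z \<or> ?N - A \<subseteq> ?N \<and> (*) n ` (?N - A) \<in> z"
      using compl by blast
  qed
qed

text \<open>If \<open>z = nr\<close>, then \<open>nN \<in> z\<close> since \<open>(nN)/n = N\<close>. Conversely, the quotient \<open>r\<close> is the
  pullback of \<open>z\<close>: because \<open>n(A/n) = A \<inter> nN\<close> and \<open>nN \<in> z\<close>, the sets \<open>A\<close> in \<open>nr\<close> are those in \<open>z\<close>.\<close>

lemma beta_dvd_iff_multiples_mem: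
  assumes n: "n \<in> pos_nats" and z: "z \<in> betaN"
  shows "beta_dvd n z \<longleftrightarrow> multiples n \<in> z"
proof
  assume "beta_dvd n z"
  then obtain r where r: "r \<in> betaN" "z = principal_uf n \<odot> r"
    by (auto simp: beta_dvd_def)
  have "set_quot (multiples n) n = pos_nats"
    using n by (auto simp: set_quot_def multiples_def)
  moreover have "pos_nats \<in> r"
    using r(1) by (simp add: betaN_def ultrafilter_on_def)
  ultimately show "multiples n \<in> z"
    using r(2) multiples_subset by (simp add: mem_principal_uf_mult[OF n])
next
  assume conc: "multiples n \<in> z"
  define r where "r = {B. B \<subseteq> pos_nats \<and> (*) n ` B \<in> z}"
  have Z: "z \<subseteq> Pow pos_nats"
      "\<And>A B. A \<in> z \<Longrightarrow> B \<in> z \<Longrightarrow> A \<inter> B \<in> z"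
      "\<And>A B. A \<in> z \<Longrightarrow> A \<subseteq> B \<Longrightarrow> B \<subseteq> pos_nats \<Longrightarrow> B \<in> z"
    using z by (simp_all add: betaN_def ultrafilter_on_def)
  have "A \<in> principal_uf n \<odot> r \<longleftrightarrow> A \<in> z" for A
  proof (cases "A \<subseteq> pos_nats")
    case True
    have "set_quot A n \<subseteq> pos_nats" by (auto simp: set_quot_def)
    then have "A \<in> principal_uf n \<odot> r \<longleftrightarrow> A \<inter> multiples n \<in> z"
      using True by (simp add: mem_principal_uf_mult[OF n] r_def image_mult_set_quot[OF n True])
    also have "\<dots> \<longleftrightarrow> A \<in> z"
      using Z(2)[OF _ conc] Z(3)[OF _ Int_lower1 True] by blast
    finally show ?thesis .
  next
    case False
    then show ?thesis using Z(1) by (auto simp: mem_principal_uf_mult[OF n])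
  qed
  then have "z = principal_uf n \<odot> r" by blast
  moreover have "r \<in> betaN"
    unfolding r_def using n z conc by (rule pullback_mult_in_betaN)
  ultimately show "beta_dvd n z" by (auto simp: beta_dvd_def)
qed

text \<open>Euclid's lemma in terms of quotient sets.\<close>

lemma set_quot_multiples_prime:
  assumes "prime n" "m \<in> pos_nats"
  shows "set_quot (multiples n) m = (if n dvd m then pos_nats else multiples n)"
  using assms by (auto simp: set_quot_def multiples_def prime_dvd_mult_iff)

theorem lemma7p2:
  fixes n :: nat and x y :: "nat set set"
  assumes "n \<in> pos_nats" and "prime n"
    and "x \<in> betaN" and "y \<in> betaN"
    and "beta_dvd n (x \<odot> y)"
  shows "beta_dvd n x \<or> beta_dvd n y"
proof (rule disjCI)
  assume "\<not> beta_dvd n y"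
  then have "multiples n \<notin> y"
    using beta_dvd_iff_multiples_mem[OF assms(1,4)] by simp
  moreover have "pos_nats \<in> y"
    using assms(4) by (simp add: betaN_def ultrafilter_on_def)
  ultimately have "{m \<in> pos_nats. set_quot (multiples n) m \<in> y} = multiples n"
    using set_quot_multiples_prime[OF assms(2)]
    by (auto simp: multiples_def[of n, THEN eqset_imp_iff] split: if_splits)
  moreover have "multiples n \<in> x \<odot> y"
    using assms(5) beta_dvd_iff_multiples_mem[OF assms(1) beta_mult_in_betaN[OF assms(3,4)]]
    by simp
  ultimately have "multiples n \<in> x" by (simp add: beta_mult_def)
  then show "beta_dvd n x"
    using beta_dvd_iff_multiples_mem[OF assms(1,3)] by simp
qed

end
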